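(* Let $N \geq 1$ be an integer. For any integer $M > 2N+1$, the Hausdorff dimension of the set $$E_M = \{ x \in (0,1) \setminus \mathbb{Q} : N \leq \varepsilon_n(x) \leq M \text{ for all } n \geq 1 \}$$ (where $\varepsilon_n(x)$ are the $N$-expansion digits of $x$) satisfies $$1 - \frac{2(N+1)}{M+1}\,\frac{1}{\log(N+1)} \;\leq\; \dim_H(E_M) \;\leq\; 1 - \frac{N}{(M + 1)\log \left( \frac{(M+1)^2}{N} \right)}.$$
   Context: Fix an integer $N\ge 1$. The $N$-expansion transformation $T_N:[0,1]\to[0,1]$ is $T_N(x) = \frac{N}{x} - \lfloor \frac{N}{x}\rfloor$ for $x\ne 0$, and $T_N(0)=0$. For irrational $x\in(0,1)$, the $N$-expansion digits are $\varepsilon_n(x) = \lfloor N / T_N^{n-1}(x)\rfloor$, $n\ge 1$; they are integers $\ge N$, and $x = \cfrac{N}{\varepsilon_1+\cfrac{N}{\varepsilon_2+\ddots}}$. $\dim_H$ denotes Hausdorff dimension and $\log$ the natural logarithm. *)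

theory Defs
  imports "HOL-Analysis.Analysis"
begin

text \<open>
  The weight \<open>|U|\<^sup>s\<close> of a bounded covering set. The exponent \<open>s = 0\<close> is separate because
  \<open>0 powr 0 = 0\<close>, whereas every nonempty set must have weight \<open>1\<close> there (so that the
  \<open>0\<close>-dimensional measure is the counting measure).
\<close>
definition hausdorff_weight :: "real \<Rightarrow> 'a::metric_space set \<Rightarrow> ennreal" where
  "hausdorff_weight s U =
     (if U = {} then 0 else if s = 0 then 1 else ennreal (diameter U powr s))"

text \<open>
  Boundedness is required explicitly since \<open>diameter\<close> is real-valued and carries no information
  for unbounded sets. Finite covers are included by padding with the empty set.
\<close>
definition delta_covers :: "real \<Rightarrow> 'a::metric_space set \<Rightarrow> (nat \<Rightarrow> 'a set) set" where
  "delta_covers \<delta> A =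
     {U. A \<subseteq> (\<Union>i. U i) \<and> (\<forall>i. bounded (U i) \<and> diameter (U i) \<le> \<delta>)}"

definition hausdorff_premeasure :: "real \<Rightarrow> real \<Rightarrow> 'a::metric_space set \<Rightarrow> ennreal" where
  "hausdorff_premeasure s \<delta> A = (INF U\<in>delta_covers \<delta> A. \<Sum>i. hausdorff_weight s (U i))"

definition hausdorff_measure :: "real \<Rightarrow> 'a::metric_space set \<Rightarrow> ennreal" where
  "hausdorff_measure s A = (SUP \<delta>\<in>{0<..}. hausdorff_premeasure s \<delta> A)"

text \<open>Extended-real-valued, so that the infimum of the empty set is \<open>\<infinity>\<close>.\<close>
definition hausdorff_dim :: "'a::metric_space set \<Rightarrow> ereal" where
  "hausdorff_dim A = Inf {ereal s |s. 0 \<le> s \<and> hausdorff_measure s A = 0}"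

definition N_trans :: "int \<Rightarrow> real \<Rightarrow> real" where
  "N_trans N x = (if x = 0 then 0 else of_int N / x - of_int \<lfloor>of_int N / x\<rfloor>)"

text \<open>Digits are indexed from \<open>n = 1\<close>; they are meant for irrational \<open>x\<close> in \<open>(0,1)\<close>.\<close>
definition N_digit :: "int \<Rightarrow> nat \<Rightarrow> real \<Rightarrow> int" where
  "N_digit N n x = \<lfloor>of_int N / (N_trans N ^^ (n - 1)) x\<rfloor>"

definition bounded_digit_set :: "int \<Rightarrow> int \<Rightarrow> real set" where
  "bounded_digit_set N M =
     {x \<in> {0<..<1} - \<rat>. \<forall>n\<ge>1. N \<le> N_digit N n x \<and> N_digit N n x \<le> M}"

end

theory Submission
  imports Defs "HOL-Library.Sublist"
begin

text \<open>
  Inside a cylinder of length \<open>\<ell>\<close> the digits above \<open>M\<close> occupy a proportion between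
  \<open>a = N/(M+1)\<close> and \<open>u = (N+1)/(M+1)\<close>, and the children of the cylinder with digits in \<open>{N..M}\<close>
  have lengths \<open>r\<^sub>k \<ell>\<close> with \<open>N/(M+1)\<^sup>2 \<le> r\<^sub>k \<le> 1/(N+1)\<close>. Hence \<open>\<Sum>\<^sub>k r\<^sub>k\<^sup>s\<close> is at most \<open>(1 - a) exp a < 1\<close>
  for the upper exponent \<open>s\<close>, so the natural covers by cylinders have vanishing weight.
  For the lower exponent it is at least \<open>(1 - u) exp (2 u) \<ge> 1\<close>; points of the set lying in
  different children are separated by a fixed proportion of the length of the parent, so a cover
  of small weight could be replaced by a family of cylinders of total weight below \<open>1\<close>, and such a
  family is avoided by some infinite digit sequence.
\<close>

section \<open>Hausdorff measure and dimension\<close>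

lemma hausdorff_dim_le:
  assumes "0 \<le> s" "hausdorff_measure s A = 0"
  shows "hausdorff_dim A \<le> ereal s"
  unfolding hausdorff_dim_def using assms by (intro Inf_lower) auto

text \<open>For \<open>s \<le> 0\<close> the hypothesis is vacuous, yet the claim holds because only
  exponents \<open>\<ge> 0\<close> enter the infimum. This matters because the lower bound of the
  theorem may be negative.\<close>

lemma hausdorff_dim_ge:
  assumes "\<And>\<sigma>. 0 \<le> \<sigma> \<Longrightarrow> \<sigma> < s \<Longrightarrow> hausdorff_measure \<sigma> A \<noteq> 0"
  shows "ereal s \<le> hausdorff_dim A"
  unfolding hausdorff_dim_def using assms by (intro Inf_greatest) force

lemma hausdorff_premeasure_le_finite_cover:
  assumes "finite W" "A \<subseteq> (\<Union>w\<in>W. U w)" "\<delta> > 0"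
    and "\<And>w. w \<in> W \<Longrightarrow> bounded (U w) \<and> diameter (U w) \<le> \<delta>"
  shows "hausdorff_premeasure s \<delta> A \<le> (\<Sum>w\<in>W. hausdorff_weight s (U w))"
proof -
  obtain h where h: "bij_betw h {0..<card W} W"
    using ex_bij_betw_nat_finite[OF assms(1)] by blast
  define V where "V i = (if i < card W then U (h i) else {})" for i
  have "A \<subseteq> (\<Union>i. V i)"
  proof
    fix x assume "x \<in> A"
    then obtain w where w: "w \<in> W" "x \<in> U w" using assms(2) by blast
    then obtain i where "i < card W" "h i = w"
      using bij_betw_imp_surj_on[OF h] by (metis atLeastLessThan_iff imageE)
    then show "x \<in> (\<Union>i. V i)" using w by (auto simp: V_def)
  qed
  moreover have "bounded (V i) \<and> diameter (V i) \<le> \<delta>" for i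
    using assms(3) assms(4)[of "h i"] bij_betwE[OF h] by (auto simp: V_def)
  ultimately have "hausdorff_premeasure s \<delta> A \<le> (\<Sum>i. hausdorff_weight s (V i))"
    unfolding hausdorff_premeasure_def delta_covers_def by (intro INF_lower) auto
  also have "\<dots> = (\<Sum>i\<in>{0..<card W}. hausdorff_weight s (V i))"
    by (intro suminf_finite) (auto simp: V_def hausdorff_weight_def)
  also have "\<dots> = (\<Sum>i\<in>{0..<card W}. hausdorff_weight s (U (h i)))"
    by (intro sum.cong) (auto simp: V_def)
  also have "\<dots> = (\<Sum>w\<in>W. hausdorff_weight s (U w))"
    using h by (rule sum.reindex_bij_betw)
  finally show ?thesis .
qed

text \<open>A covering set may have diameter 0 and weight 0, whereas cylinders have positive length.
  Replacing the diameter by a strictly larger \<open>r\<close>, at an arbitrarily small cost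
  \<open>e\<close>, leaves a positive scale at which a cylinder can be chosen.\<close>

lemma hausdorff_weight_slack:
  fixes U :: "'a::metric_space set"
  assumes "0 \<le> \<sigma>" "U \<noteq> {}" "bounded U" "e > 0"
  shows "\<exists>r > diameter U. ennreal (r powr \<sigma>) \<le> hausdorff_weight \<sigma> U + ennreal e"
proof (cases "\<sigma> = 0")
  case True
  then show ?thesis
    using assms diameter_ge_0[of U]
    by (intro exI[of _ "diameter U + 1"]) (auto simp: hausdorff_weight_def)
next
  case False
  let ?d = "diameter U"
  have d: "0 \<le> ?d" using assms by (simp add: diameter_ge_0)
  have "((\<lambda>r. r powr \<sigma>) \<longlongrightarrow> ?d powr \<sigma>) (at_right ?d)"
    using False assms(1) d
    by (intro tendsto_powr' tendsto_ident_at tendsto_const)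
       (auto simp: eventually_at_filter intro!: always_eventually)
  then have "\<forall>\<^sub>F r in at_right ?d. r powr \<sigma> < ?d powr \<sigma> + e"
    using assms(4) by (intro order_tendstoD) auto
  then obtain b where b: "b > ?d" "\<And>r. ?d < r \<Longrightarrow> r < b \<Longrightarrow> r powr \<sigma> < ?d powr \<sigma> + e"
    by (auto simp: eventually_at_right_field)
  obtain r where r: "?d < r" "r < b" using b(1) dense by blast
  have "ennreal (r powr \<sigma>) \<le> ennreal (?d powr \<sigma> + e)"
    using b(2)[OF r] by (intro ennreal_leI) auto
  then show ?thesis
    using r False assms by (auto simp: hausdorff_weight_def ennreal_plus intro!: exI[of _ r])
qed

section \<open>Avoiding a light family of nodes in a tree\<close>

text \<open>
  Words are stored in reverse, so that \<open>k # v\<close> is the child \<open>k\<close> of the node \<open>v\<close>.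
  The branch is found greedily: a node whose weight exceeds the total mass placed at or below it
  has a child with the same property.
\<close>
lemma ex_branch_avoiding:
  fixes L :: "'a list \<Rightarrow> ennreal" and w :: "nat \<Rightarrow> 'a list"
  assumes "finite K"
    and step: "\<And>v. set v \<subseteq> K \<Longrightarrow> L v \<le> (\<Sum>k\<in>K. L (k # v))"
    and small: "(\<Sum>i. a i) < L []"
  shows "\<exists>f. \<forall>n. f n \<in> K \<and> (\<forall>i. w i = rev (map f [0..<n]) \<longrightarrow> a i < L (w i))"
proof -
  define F where "F v = (\<Sum>i. if suffix v (w i) then a i else 0)" for v
  have F_children: "(\<Sum>k\<in>K. F (k # v)) \<le> F v" for v
  proof -
    have "(\<Sum>k\<in>K. F (k # v)) = (\<Sum>i. \<Sum>k\<in>K. if suffix (k # v) (w i) then a i else 0)"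
      unfolding F_def by (subst suminf_sum) auto
    also have "\<dots> \<le> F v"
      unfolding F_def
    proof (intro suminf_le allI summableI)
      fix i
      show "(\<Sum>k\<in>K. if suffix (k # v) (w i) then a i else 0) \<le> (if suffix v (w i) then a i else 0)"
      proof (cases "\<exists>k. suffix (k # v) (w i)")
        case True
        then obtain k0 where k0: "suffix (k0 # v) (w i)" by blast
        \<comment> \<open>Suffixes of one word that have equal length coincide, so each
          \<open>w i\<close> lies below at most one child of \<open>v\<close>, and its mass is
          counted at most once.\<close>
        then have eq: "suffix (k # v) (w i) \<longleftrightarrow> k = k0" for k
          by (metis append_eq_append_conv length_Cons list.inject suffix_def)
        have "suffix v (w i)" using k0 by (meson suffix_ConsD suffix_ConsI suffix_order.refl suffix_order.trans)
        then show ?thesis using assms(1) by (simp add: eq)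
      qed auto
    qed
    finally show ?thesis .
  qed
  let ?P = "\<lambda>v. set v \<subseteq> K \<and> F v < L v"
  have ex: "\<exists>k\<in>K. ?P (k # v)" if "?P v" for v
  proof (rule ccontr)
    assume "\<not> ?thesis"
    then have "\<And>k. k \<in> K \<Longrightarrow> L (k # v) \<le> F (k # v)" using that by (auto simp: not_less)
    then have "(\<Sum>k\<in>K. L (k # v)) \<le> (\<Sum>k\<in>K. F (k # v))" by (rule sum_mono)
    then have "L v \<le> F v" using step[of v] F_children[of v] that by (meson order_trans)
    then show False using that by auto
  qed
  have "\<exists>u. \<forall>n. ?P (u n) \<and> (\<exists>k\<in>K. u (Suc n) = k # u n) \<and> length (u n) = n"
  proof -
    have "\<exists>u. \<forall>n. (?P (u n) \<and> length (u n) = n) \<and> (\<exists>k\<in>K. u (Suc n) = k # u n)"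
    proof (rule dependent_nat_choice)
      show "\<exists>x. ?P x \<and> length x = 0" using small by (auto simp: F_def)
    next
      fix x n assume "?P x \<and> length x = n"
      then show "\<exists>y. (?P y \<and> length y = Suc n) \<and> (\<exists>k\<in>K. y = k # x)"
        using ex[of x] by fastforce
    qed
    then show ?thesis by blast
  qed
  then obtain u where u: "\<And>n. ?P (u n)" "\<And>n. \<exists>k\<in>K. u (Suc n) = k # u n" "length (u 0) = 0"
    by metis
  then obtain f where f: "\<And>n. f n \<in> K \<and> u (Suc n) = f n # u n" by metis
  have u_eq: "u n = rev (map f [0..<n])" for n
    using u(3) f by (induction n) auto
  have "a i < L (w i)" if "w i = rev (map f [0..<n])" for i n
  proof -
    have "a i \<le> F (w i)"
      using sum_le_suminf[of "\<lambda>j. if suffix (w i) (w j) then a j else 0" "{i}"]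
      by (auto simp: F_def summableI)
    also have "\<dots> < L (w i)" using u(1)[of n] by (simp add: that u_eq)
    finally show ?thesis .
  qed
  then show ?thesis using f by blast
qed

section \<open>Ratios of consecutive cylinder lengths\<close>

text \<open>
  The length of the child \<open>k\<close> relative to its parent, where \<open>t = q\<^sub>n\<^sub>-\<^sub>1 / q\<^sub>n\<close> is the quotient of the
  last two denominators of convergents of the parent.
\<close>
definition cyl_ratio :: "int \<Rightarrow> real \<Rightarrow> int \<Rightarrow> real" where
  "cyl_ratio N t k = of_int N * (1 + t) / ((of_int k + t * of_int N) * (of_int k + 1 + t * of_int N))"

lemma cyl_ratio_pos:
  assumes "N \<ge> 1" "0 \<le> t" "N \<le> k"
  shows "cyl_ratio N t k > 0"
  unfolding cyl_ratio_def using assms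
  by (intro divide_pos_pos mult_pos_pos add_pos_nonneg) auto

text \<open>The ratio is the difference of the values at \<open>k\<close> and \<open>k + 1\<close>
  of \<open>N (1 + t) / (k + t N)\<close>, so the sum telescopes. The value at \<open>k = N\<close>
  is 1; the subtracted term is the proportion of the parent taken by digits above
  \<open>M\<close>.\<close>

lemma sum_cyl_ratio:
  assumes "N \<ge> 1" "0 \<le> t" "N \<le> M"
  shows "(\<Sum>k=N..M. cyl_ratio N t k) = 1 - of_int N * (1 + t) / (of_int M + 1 + t * of_int N)"
proof -
  have pos: "real_of_int k + t * of_int N > 0" if "N \<le> k" for k
    using assms that by (intro add_pos_nonneg) auto
  have ratio: "cyl_ratio N t k = of_int N * (1 + t) / (of_int k + t * of_int N)
      - of_int N * (1 + t) / (of_int (k + 1) + t * of_int N)" if "N \<le> k" for k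
    unfolding cyl_ratio_def using pos[of k] pos[of "k + 1"] that
    by (simp add: divide_simps) (simp add: algebra_simps)
  have "(\<Sum>k=N..M. cyl_ratio N t k) = of_int N * (1 + t) / (of_int N + t * of_int N)
      - of_int N * (1 + t) / (of_int (M + 1) + t * of_int N)"
    using assms(3)
  proof (induction M rule: int_ge_induct)
    case base
    then show ?case by (simp add: ratio)
  next
    case (step i)
    have "{N..i+1} = insert (i+1) {N..i}" using step by auto
    then show ?case using step by (simp add: ratio)
  qed
  moreover have "of_int N * (1 + t) / (of_int N + t * of_int N) = (1::real)"
    using pos[of N] by (simp add: algebra_simps)
  ultimately show ?thesis by simp
qed

text \<open>The two factors of the denominator are at least \<open>N (1 + t)\<close> and
  \<open>N + 1\<close>, and the first cancels against the numerator.\<close>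

lemma cyl_ratio_le:
  assumes "N \<ge> 1" "0 \<le> t" "N \<le> k"
  shows "cyl_ratio N t k \<le> 1 / (of_int N + 1)"
proof -
  have tN: "0 \<le> t * of_int N" "real_of_int N \<le> of_int k" "real_of_int N \<ge> 1" using assms by auto
  have "cyl_ratio N t k \<le> of_int N * (1 + t) / (of_int N * (1 + t) * (of_int N + 1))"
    unfolding cyl_ratio_def
  proof (intro divide_left_mono mult_mono mult_pos_pos)
    show "of_int N * (1 + t) \<le> of_int k + t * of_int N" using tN by (simp add: algebra_simps)
    show "real_of_int N + 1 \<le> of_int k + 1 + t * of_int N" using tN by linarith
    show "0 \<le> of_int k + t * of_int N" "0 < of_int k + t * of_int N" "0 < of_int k + 1 + t * of_int N"
      using tN by linarith+
  qed (use assms in auto)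
  also have "\<dots> = 1 / (of_int N + 1)" using assms by simp
  finally show ?thesis .
qed

text \<open>The denominator is largest at \<open>k = M\<close>. There its growth with
  \<open>t\<close> is at most \<open>2 N (M + 1) t\<close>, by \<open>t N \<le> 1\<close>, and
  \<open>2 N \<le> M + 1\<close> lets the factor \<open>1 + t\<close> of the numerator compensate
  for it.\<close>

lemma cyl_ratio_ge:
  assumes N: "N \<ge> 1" and M: "M \<ge> 2 * N + 2" and t: "0 \<le> t" "t * of_int N \<le> 1" and k: "N \<le> k" "k \<le> M"
  shows "cyl_ratio N t k \<ge> of_int N / (of_int M + 1)\<^sup>2"
proof -
  define n m where "n = real_of_int N" and "m = real_of_int M"
  have nm: "n \<ge> 1" "m \<ge> 2 * n + 2" using N M by (auto simp: n_def m_def)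
  have "(m + t * n) * (m + 1 + t * n) = m * (m + 1) + (t * n) * (2 * m + 1 + t * n)"
    by (simp add: algebra_simps)
  also have "(t * n) * (2 * m + 1 + t * n) \<le> t * (m + 1)\<^sup>2"
  proof -
    have "n * (2 * m + 1 + t * n) \<le> n * (2 * m + 2)"
      using t nm by (intro mult_left_mono) (auto simp: n_def)
    also have "\<dots> \<le> (m + 1) * (m + 1)"
      using mult_right_mono[of "2 * n" "m + 1" "m + 1"] nm by (simp add: algebra_simps)
    finally show ?thesis
      using mult_left_mono[OF _ t(1)] by (simp add: power2_eq_square mult.assoc)
  qed
  also have "m * (m + 1) + t * (m + 1)\<^sup>2 \<le> (1 + t) * (m + 1)\<^sup>2"
    using nm by (simp add: algebra_simps power2_eq_square)
  finally have A: "(m + t * n) * (m + 1 + t * n) \<le> (1 + t) * (m + 1)\<^sup>2" by simp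
  have B: "(of_int k + t * n) * (of_int k + 1 + t * n) \<le> (m + t * n) * (m + 1 + t * n)"
    using k N t nm by (intro mult_mono) (auto simp: m_def n_def)
  have pos: "(of_int k + t * n) * (of_int k + 1 + t * n) > 0"
    using k N t by (intro mult_pos_pos add_pos_nonneg) (auto simp: n_def)
  have "n / (m + 1)\<^sup>2 = n * (1 + t) / ((1 + t) * (m + 1)\<^sup>2)" using t by simp
  also have "\<dots> \<le> n * (1 + t) / ((of_int k + t * n) * (of_int k + 1 + t * n))"
    using A B pos t nm by (intro divide_left_mono) auto
  finally show ?thesis by (simp add: cyl_ratio_def n_def m_def)
qed

text \<open>Split \<open>r powr s\<close> as \<open>r * r powr (s - 1)\<close>. Since
  \<open>s \<le> 1\<close>, the second factor is largest at the lower bound \<open>\<rho>\<close>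
  for the ratios, and \<open>s\<close> is chosen so that \<open>\<rho> powr (s - 1) = exp a\<close>.
  What remains is the telescoping sum.\<close>

lemma sum_cyl_ratio_powr_le:
  assumes N: "N \<ge> 1" and M: "M \<ge> 2 * N + 2" and t: "0 \<le> t" "t * of_int N \<le> 1"
    and s: "s = 1 - of_int N / ((of_int M + 1) * ln ((of_int M + 1)\<^sup>2 / of_int N))"
  shows "(\<Sum>k=N..M. cyl_ratio N t k powr s)
           \<le> (1 - of_int N / (of_int M + 1)) * exp (of_int N / (of_int M + 1))"
proof -
  define \<rho> where "\<rho> = of_int N / (real_of_int M + 1)\<^sup>2"
  define a where "a = of_int N / (real_of_int M + 1)"
  have NM: "2 * real_of_int N + 2 \<le> of_int M" "real_of_int N \<ge> 1" using N M by auto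
  then have "real_of_int N < (real_of_int M + 1) * 1" by simp
  also have "\<dots> \<le> (real_of_int M + 1)\<^sup>2"
    unfolding power2_eq_square using NM by (intro mult_left_mono) auto
  finally have \<rho>: "0 < \<rho>" "\<rho> < 1" using N M by (auto simp: \<rho>_def)
  have lnr: "ln ((of_int M + 1)\<^sup>2 / of_int N) = - ln \<rho>"
    using N M by (simp add: \<rho>_def ln_div)
  have s': "s - 1 = a / ln \<rho>" by (simp add: s a_def lnr)
  have a0: "0 \<le> a" using N M by (simp add: a_def)
  have s1: "s - 1 \<le> 0"
    unfolding s' using \<rho> a0 by (intro divide_nonneg_neg) auto
  have "(\<Sum>k=N..M. cyl_ratio N t k powr s) \<le> (\<Sum>k=N..M. cyl_ratio N t k * exp a)"
  proof (rule sum_mono)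
    fix k assume k: "k \<in> {N..M}"
    have p: "cyl_ratio N t k > 0" using cyl_ratio_pos[of N t k] N t k by auto
    have "cyl_ratio N t k powr s = cyl_ratio N t k * cyl_ratio N t k powr (s - 1)"
      using p powr_add[of "cyl_ratio N t k" 1 "s - 1"] by simp
    also have "cyl_ratio N t k powr (s - 1) \<le> \<rho> powr (s - 1)"
      using cyl_ratio_ge[OF N M t, of k] k \<rho> s1 by (intro powr_mono2') (auto simp: \<rho>_def)
    also have "\<rho> powr (s - 1) = exp a" using \<rho> by (simp add: powr_def s')
    finally show "cyl_ratio N t k powr s \<le> cyl_ratio N t k * exp a" using p by simp
  qed
  also have "\<dots> = (1 - of_int N * (1 + t) / (of_int M + 1 + t * of_int N)) * exp a"
    using N M t by (simp add: sum_cyl_ratio flip: sum_distrib_right)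
  \<comment> \<open>The proportion lost to large digits is smallest at \<open>t = 0\<close>, where
    it equals \<open>a\<close>.\<close>
  also have "\<dots> \<le> (1 - a) * exp a"
  proof -
    have "of_int N * (of_int M + 1 + t * of_int N) \<le> of_int N * (1 + t) * (real_of_int M + 1)"
    proof -
      have "t * of_int N \<le> t * (real_of_int M + 1)" using t N M by (intro mult_left_mono) auto
      then have "of_int M + 1 + t * of_int N \<le> (1 + t) * (real_of_int M + 1)"
        by (simp add: algebra_simps)
      then show ?thesis using N by (simp add: mult.assoc)
    qed
    moreover have "real_of_int M + 1 + t * of_int N > 0" using N M t by (intro add_pos_nonneg) auto
    ultimately have "a \<le> of_int N * (1 + t) / (of_int M + 1 + t * of_int N)"
      unfolding a_def using N M by (simp add: divide_simps)
    then show ?thesis by simp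
  qed
  finally show ?thesis by (simp add: a_def)
qed

text \<open>The same splitting with the upper bound \<open>1 / (N + 1)\<close> for the ratios: the
  bound on \<open>s\<close> makes \<open>r powr (s - 1)\<close> at least \<open>exp (2 u)\<close>.
  The proportion lost is at most \<open>u\<close>, and
  \<open>(1 - u) (1 + 2 u) = 1 + u (1 - 2 u) \<ge> 1\<close>, where \<open>2 u \<le> 1\<close> comes
  from the size of \<open>M\<close>.\<close>

lemma sum_cyl_ratio_powr_ge:
  assumes N: "N \<ge> 1" and M: "M \<ge> 2 * N + 2" and t: "0 \<le> t" "t * of_int N \<le> 1"
    and s: "s \<le> 1 - 2 * (of_int N + 1) / (of_int M + 1) * (1 / ln (of_int N + 1))"
  shows "1 \<le> (\<Sum>k=N..M. cyl_ratio N t k powr s)"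
proof -
  define u where "u = (real_of_int N + 1) / (of_int M + 1)"
  have u: "0 \<le> u" "2 * u \<le> 1" using N M by (auto simp: u_def)
  have lnN: "ln (real_of_int N + 1) > 0" using N by simp
  have "2 * (of_int N + 1) / (of_int M + 1) * (1 / ln (real_of_int N + 1)) = 2 * u / ln (real_of_int N + 1)"
    by (simp add: u_def)
  then have "2 * u / ln (real_of_int N + 1) \<le> 1 - s" using s by linarith
  then have s': "2 * u \<le> (1 - s) * ln (real_of_int N + 1)"
    using lnN by (simp add: pos_divide_le_eq)
  then have "0 \<le> (1 - s) * ln (real_of_int N + 1)" using u by linarith
  then have s1: "s - 1 \<le> 0" using lnN by (simp add: zero_le_mult_iff)
  have "1 \<le> (1 - u) * (1 + 2 * u)"
    using mult_nonneg_nonneg[of u "1 - 2 * u"] u by (simp add: algebra_simps)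
  also have "\<dots> \<le> (1 - u) * exp (2 * u)"
    using u exp_ge_add_one_self[of "2 * u"] by (intro mult_left_mono) auto
  also have "\<dots> \<le> (1 - of_int N * (1 + t) / (of_int M + 1 + t * of_int N)) * exp (2 * u)"
  proof -
    have "of_int N * (1 + t) \<le> real_of_int N + 1" using t by (simp add: algebra_simps)
    then have "of_int N * (1 + t) / (of_int M + 1 + t * of_int N) \<le> u"
      unfolding u_def using N M t by (intro frac_le) auto
    then show ?thesis by simp
  qed
  also have "\<dots> = (\<Sum>k=N..M. cyl_ratio N t k * exp (2 * u))"
    using N M t by (simp add: sum_cyl_ratio flip: sum_distrib_right)
  also have "\<dots> \<le> (\<Sum>k=N..M. cyl_ratio N t k powr s)"
  proof (rule sum_mono)
    fix k assume k: "k \<in> {N..M}"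
    have p: "cyl_ratio N t k > 0" using cyl_ratio_pos[of N t k] N t k by auto
    have "exp (2 * u) \<le> (1 / (real_of_int N + 1)) powr (s - 1)"
      using s' N by (simp add: powr_def ln_div algebra_simps)
    also have "\<dots> \<le> cyl_ratio N t k powr (s - 1)"
      using cyl_ratio_le[of N t k] k N t p s1 by (intro powr_mono2') auto
    finally have "cyl_ratio N t k * exp (2 * u) \<le> cyl_ratio N t k * cyl_ratio N t k powr (s - 1)"
      using p by simp
    also have "\<dots> = cyl_ratio N t k powr s"
      using p powr_add[of "cyl_ratio N t k" 1 "s - 1"] by simp
    finally show "cyl_ratio N t k * exp (2 * u) \<le> cyl_ratio N t k powr s" .
  qed
  finally show ?thesis .
qed

section \<open>Cylinders of the N-expansion\<close>

locale bounded_N_expansion =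
  fixes N M :: int
  assumes N_ge: "N \<ge> 1" and M_ge: "M \<ge> 2 * N + 2"
begin

abbreviation E :: "real set" where "E \<equiv> bounded_digit_set N M"
abbreviation T :: "real \<Rightarrow> real" where "T \<equiv> N_trans N"

definition digits :: "nat \<Rightarrow> real \<Rightarrow> int list" where
  "digits n x = rev (map (\<lambda>i. \<lfloor>of_int N / (T ^^ i) x\<rfloor>) [0..<n])"

text \<open>The inverse branch of the \<open>n\<close>-th iterate of \<open>T\<close> belonging to a
  word of length \<open>n\<close>. The head of the word is the deepest digit, hence it acts on
  \<open>y\<close> first.\<close>

primrec cyl :: "int list \<Rightarrow> real \<Rightarrow> real" where
  "cyl [] y = y"
| "cyl (k # v) y = cyl v (of_int N / (of_int k + y))"

text \<open>The pair \<open>(q\<^sub>n, q\<^sub>n\<^sub>-\<^sub>1)\<close> of denominators of consecutive convergents.\<close>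
primrec den :: "int list \<Rightarrow> real \<times> real" where
  "den [] = (1, 0)"
| "den (k # v) = (of_int k * fst (den v) + of_int N * snd (den v), fst (den v))"

text \<open>The distance between the end points \<open>cyl v 0\<close> and \<open>cyl v 1\<close> of
  the cylinder.\<close>

definition len :: "int list \<Rightarrow> real" where
  "len v = of_int N ^ length v / (fst (den v) * (fst (den v) + snd (den v)))"

definition slope :: "int list \<Rightarrow> real" where
  "slope v = snd (den v) / fst (den v)"

lemma cyl_append: "cyl (u @ v) y = cyl v (cyl u y)"
  by (induction u arbitrary: y) auto

lemma den_bounds:
  assumes "set v \<subseteq> {N..M}"
  shows "fst (den v) > 0 \<and> 0 \<le> snd (den v) \<and> of_int N * snd (den v) \<le> fst (den v)"
  using assms
proof (induction v)
  case (Cons k v)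
  then have IH: "fst (den v) > 0" "0 \<le> snd (den v)" by auto
  have k: "real_of_int k \<ge> of_int N" "real_of_int N \<ge> 1" using Cons.prems N_ge by auto
  have "of_int N * fst (den v) \<le> of_int k * fst (den v)"
    using k IH by (intro mult_right_mono) auto
  moreover have "0 < of_int N * fst (den v)" "0 \<le> of_int N * snd (den v)"
    using k IH by auto
  ultimately have "0 < of_int k * fst (den v) + of_int N * snd (den v)"
    "of_int N * fst (den v) \<le> of_int k * fst (den v) + of_int N * snd (den v)"
    by linarith+
  then show ?case using IH by simp
qed auto

lemma slope_bounds:
  assumes "set v \<subseteq> {N..M}"
  shows "0 \<le> slope v" "slope v * of_int N \<le> 1"
  using den_bounds[OF assms] by (auto simp: slope_def divide_simps mult.commute)

lemma len_pos:
  assumes "set v \<subseteq> {N..M}"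
  shows "len v > 0"
  unfolding len_def using den_bounds[OF assms] N_ge
  by (intro divide_pos_pos mult_pos_pos add_pos_nonneg) auto

lemma len_Nil [simp]: "len [] = 1"
  by (simp add: len_def)

text \<open>The child has denominators \<open>X = k C + N D\<close> and \<open>C\<close>. Expressing
  the quotient of the two lengths through \<open>t = D / C\<close> gives exactly the formula of
  \<open>cyl_ratio\<close>.\<close>

lemma len_Cons:
  assumes "set v \<subseteq> {N..M}" "k \<in> {N..M}"
  shows "len (k # v) = len v * cyl_ratio N (slope v) k"
proof -
  define C D where "C = fst (den v)" and "D = snd (den v)"
  have CD: "C > 0" "D \<ge> 0" using den_bounds[OF assms(1)] by (auto simp: C_def D_def)
  define X where "X = of_int k * C + of_int N * D"
  have "of_int k * C > 0" "of_int N * D \<ge> 0" using CD assms N_ge by auto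
  then have X: "X > 0" "X + C > 0" using CD by (auto simp: X_def)
  have eqs: "of_int k + D / C * of_int N = X / C" "of_int k + 1 + D / C * of_int N = (X + C) / C"
    "1 + D / C = (C + D) / C"
    using CD by (auto simp: X_def field_simps)
  have "m * (e / c) / ((x / c) * (y / c)) = m * c * e / (x * y)" if "c > 0" for m e c x y :: real
    using that by simp
  then have "cyl_ratio N (D / C) k = of_int N * C * (C + D) / (X * (X + C))"
    unfolding cyl_ratio_def eqs using CD by blast
  moreover have "len (k # v) = of_int N * of_int N ^ length v / (X * (X + C))"
    by (simp add: len_def X_def C_def D_def)
  moreover have "len v = of_int N ^ length v / (C * (C + D))" "slope v = D / C"
    by (simp_all add: len_def slope_def C_def D_def)
  moreover have "C + D > 0" using CD by linarith
  ultimately show ?thesis using CD by simp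
qed

lemma len_le: "set v \<subseteq> {N..M} \<Longrightarrow> len v \<le> (1 / 2) ^ length v"
proof (induction v)
  case (Cons k v)
  then have v: "set v \<subseteq> {N..M}" and k: "k \<in> {N..M}" by auto
  have "cyl_ratio N (slope v) k \<le> 1 / (of_int N + 1)"
    using slope_bounds[OF v] N_ge k by (intro cyl_ratio_le) auto
  also have "\<dots> \<le> 1 / 2" using N_ge by (simp add: field_simps)
  finally have "len v * cyl_ratio N (slope v) k \<le> (1 / 2) ^ length v * (1 / 2)"
    using Cons.IH[OF v] len_pos[OF v] cyl_ratio_pos[of N "slope v" k] slope_bounds[OF v] N_ge k
    by (intro mult_mono) auto
  then show ?case using len_Cons[OF v k] by simp
qed simp

text \<open>\<open>cyl v\<close> is a Moebius map with denominator
  \<open>fst (den v) + snd (den v) * y\<close> and determinant of modulus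
  \<open>N ^ length v\<close>. The induction handles differences of values only, so numerators of
  convergents never appear.\<close>

lemma cyl_diff:
  assumes "set v \<subseteq> {N..M}" "0 \<le> x" "0 \<le> y"
  shows "\<bar>cyl v x - cyl v y\<bar> = of_int N ^ length v * \<bar>x - y\<bar>
           / ((fst (den v) + snd (den v) * x) * (fst (den v) + snd (den v) * y))"
  using assms
proof (induction v arbitrary: x y)
  case (Cons k v)
  define C D where "C = fst (den v)" and "D = snd (den v)"
  have v: "set v \<subseteq> {N..M}" and k: "k \<in> {N..M}" using Cons.prems by auto
  have CD: "C > 0" "D \<ge> 0" using den_bounds[OF v] by (auto simp: C_def D_def)
  define X Y where "X = of_int k + x" and "Y = of_int k + y"
  have XY: "X > 0" "Y > 0" using Cons.prems N_ge by (auto simp: X_def Y_def)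
  have n: "of_int N > (0::real)" using N_ge by simp
  have "\<bar>cyl (k # v) x - cyl (k # v) y\<bar> = of_int N ^ length v * \<bar>of_int N / X - of_int N / Y\<bar>
           / ((C + D * (of_int N / X)) * (C + D * (of_int N / Y)))"
    using Cons.IH[OF v, of "of_int N / X" "of_int N / Y"] XY n
    by (simp add: X_def Y_def C_def D_def)
  also have "of_int N / X - of_int N / Y = of_int N * (Y - X) / (X * Y)"
    using XY by (simp add: field_simps)
  also have "\<bar>of_int N * (Y - X) / (X * Y)\<bar> = of_int N * \<bar>x - y\<bar> / (X * Y)"
    using XY n by (simp add: abs_mult X_def Y_def abs_minus_commute)
  also have "C + D * (of_int N / X) = (C * X + D * of_int N) / X"
    using XY by (simp add: field_simps)
  also have "C + D * (of_int N / Y) = (C * Y + D * of_int N) / Y"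
    using XY by (simp add: field_simps)
  also have "of_int N ^ length v * (of_int N * \<bar>x - y\<bar> / (X * Y)) /
      ((C * X + D * of_int N) / X * ((C * Y + D * of_int N) / Y))
    = of_int N ^ length (k # v) * \<bar>x - y\<bar> / ((C * X + D * of_int N) * (C * Y + D * of_int N))"
    using XY by simp
  finally show ?case
    by (simp add: X_def Y_def C_def D_def algebra_simps)
qed simp

lemma cyl_diff_le:
  assumes "set v \<subseteq> {N..M}" "x \<in> {0..1}" "y \<in> {0..1}"
  shows "\<bar>cyl v x - cyl v y\<bar> \<le> len v"
proof -
  define C D where "C = fst (den v)" and "D = snd (den v)"
  have CD: "C > 0" "D \<ge> 0" using den_bounds[OF assms(1)] by (auto simp: C_def D_def)
  have p: "C + D * x > 0" "C + D * y > 0" using CD assms by (auto intro!: add_pos_nonneg)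
  have "\<bar>x - y\<bar> * (C * (C + D)) = \<bar>x - y\<bar> * (C * C) + \<bar>x - y\<bar> * (C * D)"
    by (simp add: algebra_simps)
  \<comment> \<open>The factor \<open>\<bar>x - y\<bar>\<close> is bounded by 1 in the first term
    and by \<open>x + y\<close> in the second, to match the expansion of
    \<open>(C + D x) (C + D y)\<close>.\<close>
  also have "\<dots> \<le> 1 * (C * C) + (x + y) * (C * D)"
    using CD assms by (intro add_mono mult_right_mono) auto
  also have "\<dots> \<le> 1 * (C * C) + (x + y) * (C * D) + D * x * (D * y)"
    using CD assms by simp
  also have "\<dots> = (C + D * x) * (C + D * y)" by (simp add: algebra_simps)
  finally have "\<bar>x - y\<bar> / ((C + D * x) * (C + D * y)) \<le> 1 / (C * (C + D))"
    using p CD by (simp add: divide_simps add_pos_nonneg)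
  then have "of_int N ^ length v * (\<bar>x - y\<bar> / ((C + D * x) * (C + D * y)))
      \<le> of_int N ^ length v * (1 / (C * (C + D)))"
    using N_ge by (intro mult_left_mono) auto
  then show ?thesis
    using cyl_diff[OF assms(1), of x y] assms by (simp add: len_def C_def D_def)
qed

text \<open>Bounded distortion: since \<open>D \<le> C\<close>, the denominator in
  \<open>cyl_diff\<close> is at most \<open>2 C (C + D)\<close>, twice the one in
  \<open>len\<close>.\<close>

lemma cyl_diff_ge:
  assumes "set v \<subseteq> {N..M}" "x \<in> {0..1}" "y \<in> {0..1}"
  shows "len v * \<bar>x - y\<bar> / 2 \<le> \<bar>cyl v x - cyl v y\<bar>"
proof -
  define C D where "C = fst (den v)" and "D = snd (den v)"
  have CD: "C > 0" "D \<ge> 0" "of_int N * D \<le> C"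
    using den_bounds[OF assms(1)] by (auto simp: C_def D_def)
  have "1 * D \<le> of_int N * D" using N_ge CD by (intro mult_right_mono) auto
  then have DC: "D \<le> C" using CD by linarith
  have p: "C + D * x > 0" "C + D * y > 0" using CD assms by (auto intro!: add_pos_nonneg)
  have "D * x \<le> D * 1" "D * y \<le> D * 1"
    using mult_left_mono[OF _ CD(2), of _ 1] assms by auto
  then have "(C + D * x) * (C + D * y) \<le> (C + D) * (2 * C)"
    using p CD DC by (intro mult_mono) auto
  then have "\<bar>x - y\<bar> / (2 * (C * (C + D))) \<le> \<bar>x - y\<bar> / ((C + D * x) * (C + D * y))"
    using p CD by (intro divide_left_mono mult_pos_pos) (auto simp: algebra_simps)
  then have "of_int N ^ length v * (\<bar>x - y\<bar> / (2 * (C * (C + D))))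
      \<le> of_int N ^ length v * (\<bar>x - y\<bar> / ((C + D * x) * (C + D * y)))"
    using N_ge by (intro mult_left_mono) auto
  then show ?thesis
    using cyl_diff[OF assms(1), of x y] assms by (simp add: len_def C_def D_def field_simps)
qed

section \<open>Points with bounded digits\<close>

lemma E_step:
  assumes "x \<in> E"
  shows "T x \<in> E" "\<lfloor>of_int N / x\<rfloor> \<in> {N..M}" "x = of_int N / (of_int \<lfloor>of_int N / x\<rfloor> + T x)"
    "0 < x" "x < 1"
proof -
  have x: "0 < x" "x < 1" "x \<notin> \<rat>" and
    dig: "\<And>n. n \<ge> 1 \<Longrightarrow> N_digit N n x \<in> {N..M}"
    using assms by (auto simp: bounded_digit_set_def)
  have Tx: "T x = of_int N / x - of_int \<lfloor>of_int N / x\<rfloor>" using x by (simp add: N_trans_def)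
  have "T x \<notin> \<rat>"
  proof
    assume "T x \<in> \<rat>"
    then have "T x + of_int \<lfloor>of_int N / x\<rfloor> \<in> \<rat>" by (intro Rats_add) auto
    then have "of_int N / x \<in> \<rat>" by (simp add: Tx)
    then have "of_int N / (of_int N / x) \<in> \<rat>" by (rule Rats_divide[OF Rats_of_int])
    then show False using x N_ge by simp
  qed
  moreover have "0 \<le> T x" "T x < 1" unfolding Tx by linarith+
  ultimately have "T x \<in> {0<..<1} - \<rat>" by (cases "T x = 0") auto
  moreover have "N_digit N n (T x) \<in> {N..M}" if "n \<ge> 1" for n
  proof -
    have "N_digit N n (T x) = N_digit N (Suc n) x"
      using that by (cases n) (auto simp: N_digit_def funpow_swap1)
    then show ?thesis using dig[of "Suc n"] by simp
  qed
  ultimately show "T x \<in> E" by (auto simp: bounded_digit_set_def)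
  show "\<lfloor>of_int N / x\<rfloor> \<in> {N..M}" using dig[of 1] by (simp add: N_digit_def)
  show "x = of_int N / (of_int \<lfloor>of_int N / x\<rfloor> + T x)" using x N_ge by (simp add: Tx)
  show "0 < x" "x < 1" using x by auto
qed

lemma E_funpow: "x \<in> E \<Longrightarrow> (T ^^ n) x \<in> E"
  by (induction n) (auto simp: E_step)

lemma length_digits [simp]: "length (digits n x) = n"
  by (simp add: digits_def)

lemma digits_0 [simp]: "digits 0 x = []"
  by (simp add: digits_def)

lemma digits_Suc: "digits (Suc n) x = \<lfloor>of_int N / (T ^^ n) x\<rfloor> # digits n x"
  by (simp add: digits_def)

lemma set_digits:
  assumes "x \<in> E"
  shows "set (digits n x) \<subseteq> {N..M}"
  using E_step(2)[OF E_funpow[OF assms]] by (auto simp: digits_def simp del: atLeastAtMost_iff)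

lemma cyl_digits:
  assumes "x \<in> E"
  shows "cyl (digits n x) ((T ^^ n) x) = x"
proof (induction n)
  case (Suc n)
  then show ?case
    using E_step(3)[OF E_funpow[OF assms], of n] by (simp add: digits_Suc)
qed simp

lemma E_gt:
  assumes "x \<in> E"
  shows "x > of_int N / (of_int M + 1)"
proof -
  have "\<lfloor>of_int N / x\<rfloor> \<le> M" using E_step(2)[OF assms] by simp
  then have "of_int N / x < of_int M + 1" by linarith
  then show ?thesis
    using E_step(4)[OF assms] N_ge M_ge by (simp add: divide_simps mult.commute)
qed

text \<open>
  The digit intervals of \<open>x\<close> and \<open>y\<close> may be adjacent, but points of \<open>E\<close> stay away from \<open>0\<close>
  and hence from one end of their digit interval.
\<close>
lemma E_gap:
  assumes "x \<in> E" "y \<in> E" "\<lfloor>of_int N / x\<rfloor> < \<lfloor>of_int N / y\<rfloor>"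
  shows "\<bar>x - y\<bar> \<ge> (of_int N / (of_int M + 1)) * (of_int N / (of_int M + 1)\<^sup>2)"
proof -
  define X where "X = of_int N / x"
  define Y where "Y = of_int N / y"
  have xy: "0 < x" "0 < y" using E_step(4) assms by auto
  have a: "of_int N / (real_of_int M + 1) > 0" using N_ge M_ge by auto
  have XY: "X > 0" "Y > 0" using xy N_ge by (auto simp: X_def Y_def)
  have "\<lfloor>X\<rfloor> \<le> M" "\<lfloor>Y\<rfloor> \<le> M"
    using E_step(2)[OF assms(1)] E_step(2)[OF assms(2)] by (auto simp: X_def Y_def)
  then have le: "X \<le> of_int M + 1" "Y \<le> of_int M + 1" by linarith+
  have "Y - of_int \<lfloor>Y\<rfloor> > of_int N / (of_int M + 1)"
    using E_gt[OF E_step(1)[OF assms(2)]] xy by (simp add: N_trans_def Y_def)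
  \<comment> \<open>\<open>X < \<lfloor>X\<rfloor> + 1 \<le> \<lfloor>Y\<rfloor>\<close>, so
    \<open>Y - X\<close> exceeds the fractional part of \<open>Y\<close>, which is
    \<open>T y\<close>.\<close>
  then have diff: "Y - X \<ge> of_int N / (of_int M + 1)"
    using assms(3) unfolding X_def[symmetric] Y_def[symmetric] by linarith
  have "x - y = of_int N / X - of_int N / Y" using xy N_ge by (simp add: X_def Y_def)
  also have "\<dots> = (Y - X) * (of_int N / (X * Y))" using XY by (simp add: field_simps)
  also have "\<dots> \<ge> (of_int N / (of_int M + 1)) * (of_int N / (of_int M + 1)\<^sup>2)"
  proof (rule mult_mono)
    have "X * Y \<le> (of_int M + 1)\<^sup>2" unfolding power2_eq_square using XY le by (intro mult_mono) auto
    then show "of_int N / (real_of_int M + 1)\<^sup>2 \<le> of_int N / (X * Y)"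
      using XY N_ge M_ge by (intro divide_left_mono mult_pos_pos) auto
  qed (use diff a N_ge in auto)
  finally show ?thesis by linarith
qed

text \<open>Infinite descent on the denominator: if \<open>x = p / q\<close> lies in the open unit
  interval, then \<open>p < q\<close> and \<open>p\<close> is a denominator of \<open>T x\<close>.
  It yields the irrationality of points built from digit sequences.\<close>

lemma rational_orbit_leaves_unit_interval:
  assumes "q > 0" "x * of_nat q \<in> \<int>" "\<And>n. (T ^^ n) x \<in> {0<..<1}"
  shows False
  using assms
proof (induction q arbitrary: x rule: less_induct)
  case (less q)
  have x: "0 < x" "x < 1" using less.prems(3)[of 0] by auto
  obtain p where p: "x * of_nat q = of_int p" using less.prems(2) by (auto elim: Ints_cases)
  have pos: "x * of_nat q > 0" using x less.prems(1) by simp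
  have "x * of_nat q < of_nat q" using x less.prems(1) by simp
  with pos have p_bounds: "0 < p" "p < int q" unfolding p by linarith+
  have "T x * of_nat (nat p) = of_int N / x * (x * of_nat q) - of_int \<lfloor>of_int N / x\<rfloor> * of_int p"
    using x p_bounds p by (simp add: N_trans_def algebra_simps)
  also have "\<dots> = of_int (N * int q - \<lfloor>of_int N / x\<rfloor> * p)" using x by simp
  finally have "T x * of_nat (nat p) \<in> \<int>" by simp
  moreover have "(T ^^ n) (T x) \<in> {0<..<1}" for n
    using less.prems(3)[of "Suc n"] by (simp add: funpow_swap1)
  moreover have "nat p < q" "nat p > 0" using p_bounds by auto
  ultimately show False by (intro less.IH[of "nat p" "T x"])
qed

text \<open>The tails \<open>y n\<close> will arise as limits, hence only the closed interval is
  assumed. The recursion excludes the end points, first 0 and then 1, so that \<open>f n\<close> is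
  the floor of \<open>N / y n\<close>.\<close>

lemma in_E_if_digit_expansion:
  assumes y: "\<And>n. y n \<in> {0..1}" and f: "\<And>n. f n \<in> {N..M}"
    and rec: "\<And>n. y n = of_int N / (of_int (f n) + y (Suc n))"
  shows "y 0 \<in> E" "digits n (y 0) = rev (map f [0..<n])"
proof -
  have y_pos: "0 < y n" for n
    using y[of "Suc n"] f[of n] N_ge by (subst rec) (auto intro!: divide_pos_pos add_pos_nonneg)
  have y_lt: "y n < 1" for n
    using y_pos[of "Suc n"] f[of n] N_ge by (subst rec) (auto simp: divide_simps add_pos_pos)
  have quot: "of_int N / y n = of_int (f n) + y (Suc n)" for n
    using y_pos[of n] y_pos[of "Suc n"] f[of n] N_ge by (subst rec) (auto simp: divide_simps)
  have fl: "\<lfloor>of_int N / y n\<rfloor> = f n" for n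
    unfolding quot using y_pos[of "Suc n"] y_lt[of "Suc n"] by (intro floor_unique) auto
  have "T (y n) = y (Suc n)" for n
    using y_pos[of n] fl[of n] quot[of n] by (simp add: N_trans_def)
  then have Tn: "(T ^^ n) (y 0) = y n" for n by (induction n) auto
  show "digits n (y 0) = rev (map f [0..<n])" by (simp add: digits_def Tn fl)
  have "y 0 \<notin> \<rat>"
  proof
    assume "y 0 \<in> \<rat>"
    then obtain a b :: int where ab: "b > 0" "y 0 = of_int a / of_int b"
      by (meson Rats_cases')
    then have "y 0 * of_nat (nat b) \<in> \<int>" by simp
    then show False
      using rational_orbit_leaves_unit_interval[of "nat b" "y 0"] ab(1) y_pos y_lt by (simp add: Tn)
  qed
  then show "y 0 \<in> E"
    using y_pos[of 0] y_lt[of 0] f by (auto simp: bounded_digit_set_def N_digit_def Tn fl)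
qed

lemma cyl_in_unit:
  assumes "set v \<subseteq> {N..M}" "y \<in> {0..1}"
  shows "cyl v y \<in> {0..1}"
  using assms
proof (induction v arbitrary: y)
  case (Cons k v)
  have "of_int N / (of_int k + y) \<in> {0..1}"
    using Cons.prems N_ge by (auto simp: divide_simps)
  then show ?case using Cons by auto
qed simp

text \<open>\<open>z m n\<close> is the finite expansion with the \<open>n\<close> digits starting
  at position \<open>m\<close>. Taking limits for all \<open>m\<close> at once gives tails that
  satisfy the recursion of the previous criterion.\<close>

lemma ex_point_of_digits:
  assumes f: "\<And>n. f n \<in> {N..M}"
  shows "\<exists>x\<in>E. \<forall>n. digits n x = rev (map f [0..<n])"
proof -
  define z where "z m n = cyl (rev (map (\<lambda>i. f (m + i)) [0..<n])) 0" for m n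
  have sub: "set (rev (map (\<lambda>i. f (m + i)) [0..<n])) \<subseteq> {N..M}" for m n
    using f by (auto simp del: atLeastAtMost_iff)
  have z01: "z m n \<in> {0..1}" for m n
    unfolding z_def using sub by (intro cyl_in_unit) auto
  have z_rec: "z m (Suc n) = of_int N / (of_int (f m) + z (Suc m) n)" for m n
  proof -
    have "map (\<lambda>i. f (m + i)) [0..<Suc n] = f m # map (\<lambda>i. f (Suc m + i)) [0..<n]"
      by (subst upt_conv_Cons) (auto simp: map_Suc_upt[symmetric] simp del: upt_Suc)
    then show ?thesis by (simp add: z_def cyl_append del: upt_Suc)
  qed
  have "convergent (z m)" for m
  proof -
    \<comment> \<open>Consecutive truncations are images of two points of \<open>[0, 1]\<close>
      under the same branch \<open>cyl ?v\<close>.\<close>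
    have "norm (z m (Suc n) - z m n) \<le> (1 / 2) ^ n" for n
    proof -
      let ?v = "rev (map (\<lambda>i. f (m + i)) [0..<n])"
      have "of_int N / of_int (f (m + n)) \<in> {0..1::real}"
        using f[of "m + n"] N_ge by (auto simp: divide_simps)
      then have "\<bar>cyl ?v (of_int N / of_int (f (m + n))) - cyl ?v 0\<bar> \<le> len ?v"
        by (intro cyl_diff_le[OF sub]) auto
      also have "\<dots> \<le> (1 / 2) ^ n" using len_le[OF sub, of m n] by simp
      finally show ?thesis by (simp add: z_def)
    qed
    then have "summable (\<lambda>n. z m (Suc n) - z m n)"
      by (intro summable_comparison_test[OF _ summable_geometric[of "1/2::real"]]) auto
    then have "convergent (\<lambda>n. \<Sum>i<n. z m (Suc i) - z m i)"
      by (simp add: summable_iff_convergent)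
    then have "convergent (\<lambda>n. z m n - z m 0)" by (simp add: sum_lessThan_telescope)
    then show ?thesis using convergent_add_const_right_iff[of "z m" "- z m 0"] by simp
  qed
  then obtain y where y: "\<And>m. z m \<longlonglongrightarrow> y m"
    unfolding convergent_def by metis
  have y01: "y m \<in> {0..1}" for m
    using closed_sequentially[OF closed_atLeastAtMost _ y[of m]] z01 by auto
  have "y m = of_int N / (of_int (f m) + y (Suc m))" for m
  proof (rule LIMSEQ_unique)
    show "(\<lambda>n. z m (Suc n)) \<longlonglongrightarrow> y m" using y by (rule LIMSEQ_Suc)
    have "of_int (f m) + y (Suc m) > 0"
      using y01[of "Suc m"] f[of m] N_ge by (intro add_pos_nonneg) auto
    then show "(\<lambda>n. z m (Suc n)) \<longlonglongrightarrow> of_int N / (of_int (f m) + y (Suc m))"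
      unfolding z_rec by (intro tendsto_intros y) auto
  qed
  then show ?thesis using in_E_if_digit_expansion[of y f, OF y01 f] by blast
qed

section \<open>The upper bound\<close>

lemma diameter_cylinder:
  assumes "set v \<subseteq> {N..M}"
  shows "bounded {x \<in> E. digits (length v) x = v}"
    and "diameter {x \<in> E. digits (length v) x = v} \<le> len v"
proof -
  show "bounded {x \<in> E. digits (length v) x = v}"
    by (rule bounded_subset[of "{0..1::real}"]) (auto simp: bounded_digit_set_def)
  have "dist x y \<le> len v" if "x \<in> E" "digits (length v) x = v" "y \<in> E" "digits (length v) y = v" for x y
    using cyl_diff_le[OF assms, of "(T ^^ length v) x" "(T ^^ length v) y"]
      cyl_digits[of x "length v"] cyl_digits[of y "length v"] that
      E_step(4,5)[OF E_funpow[of x "length v"]] E_step(4,5)[OF E_funpow[of y "length v"]]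
    by (simp add: dist_real_def)
  then show "diameter {x \<in> E. digits (length v) x = v} \<le> len v"
    using len_pos[OF assms] by (intro diameter_le) (auto simp: dist_norm)
qed

abbreviation words :: "nat \<Rightarrow> int list set" where
  "words n \<equiv> {v. set v \<subseteq> {N..M} \<and> length v = n}"

lemma sum_len_words_le:
  assumes "\<And>v. set v \<subseteq> {N..M} \<Longrightarrow> (\<Sum>k=N..M. cyl_ratio N (slope v) k powr s) \<le> c"
  shows "(\<Sum>v\<in>words n. len v powr s) \<le> c ^ n"
proof (induction n)
  case 0
  have "words 0 = {[]}" by auto
  then show ?case by simp
next
  case (Suc n)
  have c: "0 \<le> c" by (rule order_trans[OF sum_nonneg assms[of "[]"]]) auto
  have inj: "inj_on (\<lambda>(v, k). k # v) (words n \<times> {N..M})" by (auto intro!: inj_onI)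
  have "words (Suc n) = (\<lambda>(v, k). k # v) ` (words n \<times> {N..M})"
    using lists_length_Suc_eq[of "{N..M}" n] by simp
  then have "(\<Sum>v\<in>words (Suc n). len v powr s) = (\<Sum>(v, k)\<in>words n \<times> {N..M}. len (k # v) powr s)"
    using sum.reindex[OF inj, of "\<lambda>v. len v powr s"] by (simp add: case_prod_beta o_def)
  also have "\<dots> = (\<Sum>v\<in>words n. \<Sum>k=N..M. len (k # v) powr s)"
    by (rule sum.cartesian_product[symmetric])
  also have "\<dots> \<le> (\<Sum>v\<in>words n. len v powr s * c)"
  proof (rule sum_mono)
    fix v assume "v \<in> words n"
    then have v: "set v \<subseteq> {N..M}" by auto
    have "(\<Sum>k=N..M. len (k # v) powr s) = (\<Sum>k=N..M. len v powr s * cyl_ratio N (slope v) k powr s)"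
      using v len_pos[OF v] cyl_ratio_pos[OF N_ge slope_bounds(1)[OF v]]
      by (intro sum.cong refl) (auto simp: len_Cons powr_mult less_imp_le)
    also have "\<dots> \<le> len v powr s * c"
      using assms[OF v] by (simp add: mult_left_mono flip: sum_distrib_left)
    finally show "(\<Sum>k=N..M. len (k # v) powr s) \<le> len v powr s * c" .
  qed
  also have "\<dots> \<le> c ^ n * c" using Suc c by (simp add: mult_right_mono flip: sum_distrib_right)
  finally show ?case by (simp add: mult.commute)
qed

text \<open>The cylinders of generation \<open>n\<close> have diameter at most
  \<open>(1 / 2) ^ n\<close> and total weight at most \<open>c ^ n\<close>.\<close>

lemma hausdorff_measure_E_eq_0:
  assumes s: "s > 0" and "c < 1"
    and c: "\<And>v. set v \<subseteq> {N..M} \<Longrightarrow> (\<Sum>k=N..M. cyl_ratio N (slope v) k powr s) \<le> c"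
  shows "hausdorff_measure s E = 0"
proof -
  have c0: "0 \<le> c" by (rule order_trans[OF sum_nonneg c[of "[]"]]) auto
  have "hausdorff_premeasure s \<delta> E = 0" if "\<delta> > 0" for \<delta>
  proof -
    have bound: "hausdorff_premeasure s \<delta> E \<le> ennreal (c ^ n)" if n: "(1 / 2) ^ n < \<delta>" for n
    proof -
      let ?U = "\<lambda>v. {x \<in> E. digits (length v) x = v}"
      have "hausdorff_premeasure s \<delta> E \<le> (\<Sum>v\<in>words n. hausdorff_weight s (?U v))"
      proof (rule hausdorff_premeasure_le_finite_cover)
        show "finite (words n)" by (rule finite_lists_length_eq) simp
        show "E \<subseteq> (\<Union>v\<in>words n. ?U v)"
        proof
          fix x assume "x \<in> E"
          then show "x \<in> (\<Union>v\<in>words n. ?U v)"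
            using set_digits[of x n] by (intro UN_I[of "digits n x"]) auto
        qed
        fix v assume "v \<in> words n"
        then show "bounded (?U v) \<and> diameter (?U v) \<le> \<delta>"
          using diameter_cylinder[of v] len_le[of v] n by auto
      qed (use \<open>\<delta> > 0\<close> in auto)
      also have "\<dots> \<le> (\<Sum>v\<in>words n. ennreal (len v powr s))"
      proof (rule sum_mono)
        fix v assume "v \<in> words n"
        then have v: "set v \<subseteq> {N..M}" by auto
        show "hausdorff_weight s (?U v) \<le> ennreal (len v powr s)"
          using s diameter_cylinder[OF v] diameter_ge_0[of "?U v"]
          by (auto simp: hausdorff_weight_def intro!: ennreal_leI powr_mono2)
      qed
      also have "\<dots> = ennreal (\<Sum>v\<in>words n. len v powr s)" by (rule sum_ennreal) simp
      also have "\<dots> \<le> ennreal (c ^ n)" using sum_len_words_le[OF c] by (rule ennreal_leI)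
      finally show ?thesis .
    qed
    have "(\<lambda>n. (1 / 2 :: real) ^ n) \<longlonglongrightarrow> 0" by (rule LIMSEQ_power_zero) simp
    then have ev: "\<forall>\<^sub>F n in sequentially. (1 / 2 :: real) ^ n < \<delta>"
      using \<open>\<delta> > 0\<close> by (rule order_tendstoD)
    have "(\<lambda>n. ennreal (c ^ n)) \<longlonglongrightarrow> ennreal 0"
      using c0 \<open>c < 1\<close> by (intro tendsto_ennrealI LIMSEQ_power_zero) auto
    then have "hausdorff_premeasure s \<delta> E \<le> ennreal 0"
      using ev bound by (intro tendsto_lowerbound[of _ _ sequentially]) (auto elim!: eventually_mono)
    then show ?thesis by simp
  qed
  then show ?thesis unfolding hausdorff_measure_def by simp
qed

section \<open>The lower bound\<close>

text \<open>Half of the separation in \<open>E_gap\<close>; the factor 1/2 is the distortion lost in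
  \<open>cyl_diff_ge\<close>.\<close>

definition gap :: real where
  "gap = (of_int N / (of_int M + 1)) * (of_int N / (of_int M + 1)\<^sup>2) / 2"

lemma gap_pos: "gap > 0"
  using N_ge M_ge by (simp add: gap_def)

lemma dist_E_ge:
  assumes "x \<in> E" "y \<in> E" "digits n x = digits n y" "digits (Suc n) x \<noteq> digits (Suc n) y"
  shows "gap * len (digits n x) \<le> \<bar>x - y\<bar>"
proof -
  let ?x = "(T ^^ n) x" and ?y = "(T ^^ n) y"
  have xy: "?x \<in> E" "?y \<in> E" using assms E_funpow by auto
  have "\<lfloor>of_int N / ?x\<rfloor> \<noteq> \<lfloor>of_int N / ?y\<rfloor>" using assms by (simp add: digits_Suc)
  then have "2 * gap \<le> \<bar>?x - ?y\<bar>"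
    using E_gap[OF xy] E_gap[OF xy(2,1)] by (auto simp: gap_def abs_minus_commute neq_iff)
  then have "len (digits n x) * (2 * gap) / 2 \<le> len (digits n x) * \<bar>?x - ?y\<bar> / 2"
    using len_pos[OF set_digits[OF assms(1)], of n] by (intro divide_right_mono mult_left_mono) auto
  also have "\<dots> \<le> \<bar>cyl (digits n x) ?x - cyl (digits n x) ?y\<bar>"
    using E_step(4,5)[OF xy(1)] E_step(4,5)[OF xy(2)]
    by (intro cyl_diff_ge set_digits[OF assms(1)]) auto
  also have "\<dots> = \<bar>x - y\<bar>"
    using cyl_digits[OF assms(1), of n] cyl_digits[OF assms(2), of n] assms(3) by simp
  finally show ?thesis by (simp add: mult.commute)
qed

text \<open>Follow the digits of one point \<open>x\<close> of \<open>U\<close> down to the first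
  cylinder of length at most \<open>r / gap\<close>. A point of \<open>U\<close> and
  \<open>E\<close> leaving this path earlier would have distance at least \<open>r\<close> from
  \<open>x\<close>, more than the diameter of \<open>U\<close>.\<close>

lemma ex_small_cylinder:
  assumes U: "U \<inter> E \<noteq> {}" "bounded U" "diameter U < r"
  shows "\<exists>w. set w \<subseteq> {N..M} \<and> (\<forall>y\<in>U \<inter> E. digits (length w) y = w) \<and> len w \<le> r / gap"
proof -
  obtain x where x: "x \<in> U" "x \<in> E" using U by auto
  have r: "r > 0" using U diameter_ge_0[of U] by auto
  define P where "P n \<longleftrightarrow> len (digits n x) \<le> r / gap" for n
  have "\<exists>n. (1 / 2 :: real) ^ n < r / gap"
    using r gap_pos by (intro real_arch_pow_inv) auto
  then have "\<exists>n. P n"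
    using len_le[OF set_digits[OF x(2)]] unfolding P_def by (metis length_digits less_imp_le order_trans)
  define n where "n = (LEAST n. P n)"
  have n: "P n"
    unfolding n_def by (rule LeastI_ex[OF \<open>\<exists>n. P n\<close>])
  have below_n: "\<not> P m" if "m < n" for m
    by (rule not_less_Least) (use that in \<open>simp add: n_def\<close>)
  have "digits m y = digits m x" if y: "y \<in> U" "y \<in> E" and "m \<le> n" for y m
    using \<open>m \<le> n\<close>
  proof (induction m)
    case (Suc m)
    show ?case
    proof (rule ccontr)
      assume neq: "digits (Suc m) y \<noteq> digits (Suc m) x"
      have "gap * len (digits m x) \<le> \<bar>x - y\<bar>"
      proof (rule dist_E_ge[OF x(2) y(2)])
        show "digits m x = digits m y" by (rule Suc.IH[OF Suc_leD[OF Suc.prems], symmetric])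
        show "digits (Suc m) x \<noteq> digits (Suc m) y" by (rule neq[symmetric])
      qed
      also have "\<dots> \<le> diameter U"
        using diameter_bounded_bound[OF U(2) x(1) y(1)] by (simp add: dist_real_def)
      also have "\<dots> < r" by (rule U(3))
      finally have "P m" using gap_pos by (simp add: P_def field_simps)
      then show False using below_n[of m] Suc.prems by simp
    qed
  qed simp
  then show ?thesis
    using n set_digits[OF x(2), of n] by (intro exI[of _ "digits n x"]) (auto simp: P_def)
qed

lemma hausdorff_measure_E_neq_0:
  assumes s: "0 \<le> s"
    and ge: "\<And>v. set v \<subseteq> {N..M} \<Longrightarrow> 1 \<le> (\<Sum>k=N..M. cyl_ratio N (slope v) k powr s)"
  shows "hausdorff_measure s E \<noteq> 0"
proof
  assume "hausdorff_measure s E = 0"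
  moreover have "hausdorff_premeasure s 1 E \<le> hausdorff_measure s E"
    unfolding hausdorff_measure_def by (intro SUP_upper) auto
  ultimately have "hausdorff_premeasure s 1 E = 0" by simp
  \<comment> \<open>One \<open>\<kappa>\<close> pays for the cover and another for the slacks
    \<open>e i\<close>, which sum to \<open>\<kappa>\<close>. After scaling by
    \<open>gap powr (- s)\<close> the total is 2/3, below the weight 1 of the root.\<close>
  define \<kappa> where "\<kappa> = gap powr s / 3"
  have \<kappa>: "\<kappa> > 0" using gap_pos by (simp add: \<kappa>_def)
  have "hausdorff_premeasure s 1 E < ennreal \<kappa>"
    using \<open>hausdorff_premeasure s 1 E = 0\<close> \<kappa> by simp
  then obtain U where U: "E \<subseteq> (\<Union>i. U i)" "\<And>i. bounded (U i)" "(\<Sum>i. hausdorff_weight s (U i)) < ennreal \<kappa>"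
    unfolding hausdorff_premeasure_def delta_covers_def by (auto simp: INF_less_iff)
  define I where "I = {i. U i \<inter> E \<noteq> {}}"
  define e where "e i = \<kappa> * (1 / 2) ^ Suc i" for i :: nat
  have e: "e i > 0" for i using \<kappa> by (simp add: e_def)
  have "\<exists>w. i \<in> I \<longrightarrow> set w \<subseteq> {N..M} \<and> (\<forall>y\<in>U i \<inter> E. digits (length w) y = w)
      \<and> ennreal (len w powr s) \<le> ennreal (gap powr (- s)) * (hausdorff_weight s (U i) + ennreal (e i))" for i
  proof (cases "i \<in> I")
    case True
    then have "U i \<noteq> {}" by (auto simp: I_def)
    then obtain r where r: "r > diameter (U i)" "ennreal (r powr s) \<le> hausdorff_weight s (U i) + ennreal (e i)"
      using hausdorff_weight_slack[OF s _ U(2) e, of i i] by auto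
    obtain w where w: "set w \<subseteq> {N..M}" "\<forall>y\<in>U i \<inter> E. digits (length w) y = w" "len w \<le> r / gap"
      using ex_small_cylinder[OF _ U(2) r(1)] True by (auto simp: I_def)
    have "r > 0" using r(1) diameter_ge_0[OF U(2)[of i]] by linarith
    have "len w powr s \<le> (r / gap) powr s"
      using w(3) len_pos[OF w(1)] s by (intro powr_mono2) auto
    also have "\<dots> = gap powr (- s) * r powr s"
      using \<open>r > 0\<close> gap_pos by (simp add: powr_divide powr_minus field_simps)
    finally have "ennreal (len w powr s) \<le> ennreal (gap powr (- s)) * ennreal (r powr s)"
      by (simp add: ennreal_leI flip: ennreal_mult)
    also have "\<dots> \<le> ennreal (gap powr (- s)) * (hausdorff_weight s (U i) + ennreal (e i))"
      using r(2) by (intro mult_left_mono) auto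
    finally show ?thesis using w by blast
  qed auto
  then obtain w where w: "\<And>i. i \<in> I \<Longrightarrow> set (w i) \<subseteq> {N..M}"
      "\<And>i y. i \<in> I \<Longrightarrow> y \<in> U i \<Longrightarrow> y \<in> E \<Longrightarrow> digits (length (w i)) y = w i"
      "\<And>i. i \<in> I \<Longrightarrow> ennreal (len (w i) powr s)
          \<le> ennreal (gap powr (- s)) * (hausdorff_weight s (U i) + ennreal (e i))"
    by (metis IntI)
  \<comment> \<open>For \<open>i\<close> in \<open>I\<close> the mass is the full weight of
    \<open>w i\<close>, so the strict inequality along the branch forbids it to pass through
    \<open>w i\<close>. Outside \<open>I\<close> the word \<open>w i\<close> is arbitrary and
    carries no mass.\<close>
  define a where "a i = (if i \<in> I then ennreal (len (w i) powr s) else 0)" for i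
  have "(\<Sum>i. a i) \<le> (\<Sum>i. ennreal (gap powr (- s)) * (hausdorff_weight s (U i) + ennreal (e i)))"
    using w(3) by (intro suminf_le summableI allI) (auto simp: a_def)
  also have "\<dots> = ennreal (gap powr (- s)) * ((\<Sum>i. hausdorff_weight s (U i)) + (\<Sum>i. ennreal (e i)))"
    by (subst suminf_add[OF summableI summableI]) (rule ennreal_suminf_cmult)
  also have "(\<Sum>i. ennreal (e i)) = ennreal \<kappa>"
  proof (rule suminf_ennreal_eq)
    show "e sums \<kappa>" unfolding e_def using sums_mult[OF power_half_series, of \<kappa>] by simp
  qed (use e less_imp_le in blast)
  also have "ennreal (gap powr (- s)) * ((\<Sum>i. hausdorff_weight s (U i)) + ennreal \<kappa>)
      \<le> ennreal (gap powr (- s)) * (ennreal \<kappa> + ennreal \<kappa>)"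
    using U(3) by (intro mult_left_mono add_right_mono) auto
  also have "\<dots> = ennreal (gap powr (- s) * (2 * \<kappa>))"
    using \<kappa> by (simp add: ennreal_mult flip: ennreal_plus)
  also have "\<dots> = ennreal (2 / 3)"
    using gap_pos by (simp add: \<kappa>_def powr_minus field_simps)
  also have "\<dots> < ennreal (len [] powr s)" by (simp add: ennreal_lessI)
  finally have small: "(\<Sum>i. a i) < ennreal (len [] powr s)" .
  have step: "ennreal (len v powr s) \<le> (\<Sum>k\<in>{N..M}. ennreal (len (k # v) powr s))"
    if v: "set v \<subseteq> {N..M}" for v
  proof -
    have "len v powr s * 1 \<le> len v powr s * (\<Sum>k=N..M. cyl_ratio N (slope v) k powr s)"
      using ge[OF v] by (intro mult_left_mono) auto
    also have "\<dots> = (\<Sum>k=N..M. len (k # v) powr s)"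
      unfolding sum_distrib_left
      using v len_pos[OF v] cyl_ratio_pos[OF N_ge slope_bounds(1)[OF v]]
      by (intro sum.cong refl) (auto simp: len_Cons powr_mult less_imp_le)
    finally show ?thesis by (simp add: ennreal_leI)
  qed
  obtain f where f: "\<And>n. f n \<in> {N..M}"
      "\<And>n i. w i = rev (map f [0..<n]) \<Longrightarrow> a i < ennreal (len (w i) powr s)"
    using ex_branch_avoiding[of "{N..M}" "\<lambda>v. ennreal (len v powr s)" a w, OF _ step small]
    by (auto simp del: atLeastAtMost_iff)
  obtain x where x: "x \<in> E" "\<And>n. digits n x = rev (map f [0..<n])"
    using ex_point_of_digits[of f, OF f(1)] by auto
  obtain i where i: "x \<in> U i" using U(1) x(1) by auto
  then have "i \<in> I" using x by (auto simp: I_def)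
  then have "w i = rev (map f [0..<length (w i)])" using w(2)[of i x] i x by simp
  then show False using f(2)[of i] \<open>i \<in> I\<close> by (auto simp: a_def)
qed

end

theorem theorem1p1:
  fixes N M :: int
  assumes "N \<ge> 1" and "M > 2 * N + 1"
  shows "ereal (1 - 2 * (real_of_int N + 1) / (real_of_int M + 1) * (1 / ln (real_of_int N + 1)))
           \<le> hausdorff_dim (bounded_digit_set N M)
       \<and> hausdorff_dim (bounded_digit_set N M)
           \<le> ereal (1 - real_of_int N /
               ((real_of_int M + 1) * ln ((real_of_int M + 1)\<^sup>2 / real_of_int N)))"
    (is "ereal ?lo \<le> _ \<and> _ \<le> ereal ?up")
proof
  have M: "M \<ge> 2 * N + 2" using assms by linarith
  interpret bounded_N_expansion N M using assms M by unfold_locales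
  show "ereal ?lo \<le> hausdorff_dim E"
  proof (rule hausdorff_dim_ge)
    fix \<sigma> assume "0 \<le> \<sigma>" "\<sigma> < ?lo"
    then show "hausdorff_measure \<sigma> E \<noteq> 0"
      using sum_cyl_ratio_powr_ge[OF assms(1) M slope_bounds]
      by (intro hausdorff_measure_E_neq_0) auto
  qed
  define a where "a = real_of_int N / (of_int M + 1)"
  have a: "0 < a" "a < 1" using assms by (auto simp: a_def)
  \<comment> \<open>This makes the logarithm at least 1, whence \<open>?up \<ge> 1 - a > 0\<close>;
    the cylinder covers require a positive exponent.\<close>
  have "exp 1 \<le> (real_of_int M + 1)\<^sup>2 / of_int N"
  proof -
    have "exp 1 * real_of_int N \<le> 3 * (real_of_int M + 1)"
      using exp_le M assms(1) by (intro mult_mono) auto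
    also have "\<dots> \<le> (real_of_int M + 1)\<^sup>2"
      unfolding power2_eq_square using M assms(1) by (intro mult_right_mono) auto
    finally show ?thesis using assms(1) by (simp add: pos_le_divide_eq)
  qed
  then have "1 \<le> ln ((real_of_int M + 1)\<^sup>2 / of_int N)"
    using assms by (subst ln_ge_iff) auto
  then have "a / ln ((real_of_int M + 1)\<^sup>2 / of_int N) \<le> a / 1"
    using a by (intro divide_left_mono) auto
  then have up: "?up > 0" using a by (simp add: a_def)
  \<comment> \<open>The bound \<open>1 + x \<le> exp x\<close> is not strict; applying it at
    \<open>- a / 2\<close> and squaring gains the term \<open>a * a / 4\<close>, which gives the
    strict inequality.\<close>
  have "1 - a < (1 - a / 2)\<^sup>2" using a by (simp add: power2_eq_square algebra_simps)
  also have "\<dots> \<le> (exp (- a / 2))\<^sup>2"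
    using a exp_ge_add_one_self[of "- a / 2"] by (intro power_mono) auto
  also have "\<dots> = exp (- a)" by (simp flip: exp_double)
  finally have "1 - a < exp (- a)" .
  then have "(1 - a) * exp a < 1" by (simp add: exp_minus field_simps)
  then have "hausdorff_measure ?up E = 0"
    using sum_cyl_ratio_powr_le[OF assms(1) M slope_bounds refl] up
    by (intro hausdorff_measure_E_eq_0[where c = "(1 - a) * exp a"]) (auto simp: a_def)
  then show "hausdorff_dim E \<le> ereal ?up" using up by (intro hausdorff_dim_le) auto
qed

end
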